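(* Let $G$ be a regular $\Gamma$-AG-groupoid. Then the set of all $\Gamma$-ideals of $G$ forms a semilattice under the operation $\circ$ given by $A\circ B=A\Gamma B$ for all $\Gamma$-ideals $A$ and $B$ of $G$.
   Context: Let $G$ and $\Gamma$ be non-empty sets. $G$ is a $\Gamma$-AG-groupoid if there is a mapping $G\times\Gamma\times G\to G$, written $(a,\gamma,b)\mapsto a\gamma b$, such that $(a\gamma b)\delta c=(c\gamma b)\delta a$ for all $a,b,c\in G$ and $\gamma,\delta\in\Gamma$. For subsets $A,B\subseteq G$, $A\Gamma B=\{a\gamma b: a\in A,\ b\in B,\ \gamma\in\Gamma\}$. $G$ is regular if for every $a\in G$ there exist $x\in G$ and $\beta,\gamma\in\Gamma$ such that $a=(a\beta x)\gamma a$. A subset $I$ of $G$ is a $\Gamma$-ideal if $G\Gamma I\subseteq I$ and $I\Gamma G\subseteq I$. A semilattice is a commutative semigroup in which every element is idempotent. *)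

theory Defs
  imports Main
begin

locale gamma_AG_groupoid =
  fixes G :: "'a set" and \<Gamma> :: "'g set" and gmul :: "'a \<Rightarrow> 'g \<Rightarrow> 'a \<Rightarrow> 'a"
  assumes carrier_nonempty: "G \<noteq> {}"
    and gammas_nonempty: "\<Gamma> \<noteq> {}"
    and closed: "\<lbrakk>a \<in> G; \<gamma> \<in> \<Gamma>; b \<in> G\<rbrakk> \<Longrightarrow> gmul a \<gamma> b \<in> G"
    and left_invertive: "\<lbrakk>a \<in> G; b \<in> G; c \<in> G; \<gamma> \<in> \<Gamma>; \<delta> \<in> \<Gamma>\<rbrakk> \<Longrightarrow>
      gmul (gmul a \<gamma> b) \<delta> c = gmul (gmul c \<gamma> b) \<delta> a"

definition gamma_prod :: "'g set \<Rightarrow> ('a \<Rightarrow> 'g \<Rightarrow> 'a \<Rightarrow> 'a) \<Rightarrow> 'a set \<Rightarrow> 'a set \<Rightarrow> 'a set" where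
  "gamma_prod \<Gamma> gmul A B = {gmul a \<gamma> b | a \<gamma> b. a \<in> A \<and> \<gamma> \<in> \<Gamma> \<and> b \<in> B}"

locale regular_gamma_AG_groupoid = gamma_AG_groupoid +
  assumes regular: "a \<in> G \<Longrightarrow>
    \<exists>x\<in>G. \<exists>\<beta>\<in>\<Gamma>. \<exists>\<gamma>\<in>\<Gamma>. a = gmul (gmul a \<beta> x) \<gamma> a"

(* The empty set is not excluded and counts as an ideal. *)
definition gamma_ideal :: "'a set \<Rightarrow> 'g set \<Rightarrow> ('a \<Rightarrow> 'g \<Rightarrow> 'a \<Rightarrow> 'a) \<Rightarrow> 'a set \<Rightarrow> bool" where
  "gamma_ideal G \<Gamma> gmul I \<longleftrightarrow>
    I \<subseteq> G \<and> gamma_prod \<Gamma> gmul G I \<subseteq> I \<and> gamma_prod \<Gamma> gmul I G \<subseteq> I"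

(* The locales semigroup and semilattice of Main concern operations on a whole type;
   the versions here are relative to a non-empty carrier set closed under the operation. *)
locale semigroup_on =
  fixes S :: "'s set" and f :: "'s \<Rightarrow> 's \<Rightarrow> 's"
  assumes nonempty: "S \<noteq> {}"
    and closed: "\<lbrakk>x \<in> S; y \<in> S\<rbrakk> \<Longrightarrow> f x y \<in> S"
    and assoc: "\<lbrakk>x \<in> S; y \<in> S; z \<in> S\<rbrakk> \<Longrightarrow> f (f x y) z = f x (f y z)"

locale comm_semigroup_on = semigroup_on +
  assumes commute: "\<lbrakk>x \<in> S; y \<in> S\<rbrakk> \<Longrightarrow> f x y = f y x"

locale semilattice_on = comm_semigroup_on +
  assumes idem: "x \<in> S \<Longrightarrow> f x x = x"

end

theory Submission
  imports Defs
begin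

text \<open>
  In a regular \<open>\<Gamma>\<close>-AG-groupoid the product of two \<open>\<Gamma>\<close>-ideals is their intersection.
  An ideal absorbs products from either side, so \<open>A\<Gamma>B\<close> always lies in \<open>A \<inter> B\<close>; conversely
  regularity factors each element \<open>a\<close> as \<open>(a\<beta>x)\<gamma>a\<close>, and for \<open>a \<in> A \<inter> B\<close> the left factor
  \<open>a\<beta>x\<close> stays in \<open>A\<close> while the right factor is in \<open>B\<close>. The ideals are closed under
  intersection, so they inherit the semilattice laws from \<open>\<inter>\<close>.
\<close>

lemma gamma_prodI:
  "\<lbrakk>a \<in> A; \<gamma> \<in> \<Gamma>; b \<in> B\<rbrakk> \<Longrightarrow> gmul a \<gamma> b \<in> gamma_prod \<Gamma> gmul A B"
  unfolding gamma_prod_def by blast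

lemma gamma_prod_mono:
  "\<lbrakk>A \<subseteq> A'; B \<subseteq> B'\<rbrakk> \<Longrightarrow> gamma_prod \<Gamma> gmul A B \<subseteq> gamma_prod \<Gamma> gmul A' B'"
  unfolding gamma_prod_def by blast

lemma gamma_ideal_Int:
  assumes "gamma_ideal G \<Gamma> gmul A" and "gamma_ideal G \<Gamma> gmul B"
  shows "gamma_ideal G \<Gamma> gmul (A \<inter> B)"
  using assms unfolding gamma_ideal_def gamma_prod_def by blast

lemma gamma_prod_ideals_subset_Int:
  assumes "gamma_ideal G \<Gamma> gmul A" and "gamma_ideal G \<Gamma> gmul B"
  shows "gamma_prod \<Gamma> gmul A B \<subseteq> A \<inter> B"
proof -
  have "gamma_prod \<Gamma> gmul A B \<subseteq> gamma_prod \<Gamma> gmul A G"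
    and "gamma_prod \<Gamma> gmul A B \<subseteq> gamma_prod \<Gamma> gmul G B"
    using assms by (simp_all add: gamma_ideal_def gamma_prod_mono)
  then show ?thesis
    using assms unfolding gamma_ideal_def by blast
qed

lemma (in gamma_AG_groupoid) gamma_ideal_carrier: "gamma_ideal G \<Gamma> gmul G"
  unfolding gamma_ideal_def gamma_prod_def using closed by blast

lemma (in regular_gamma_AG_groupoid) gamma_prod_ideals_eq_Int:
  assumes A: "gamma_ideal G \<Gamma> gmul A" and B: "gamma_ideal G \<Gamma> gmul B"
  shows "gamma_prod \<Gamma> gmul A B = A \<inter> B"
proof
  show "gamma_prod \<Gamma> gmul A B \<subseteq> A \<inter> B"
    using A B by (rule gamma_prod_ideals_subset_Int)
  show "A \<inter> B \<subseteq> gamma_prod \<Gamma> gmul A B"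
  proof
    fix a assume a: "a \<in> A \<inter> B"
    then have "a \<in> G"
      using A unfolding gamma_ideal_def by blast
    then obtain x \<beta> \<gamma> where x: "x \<in> G" "\<beta> \<in> \<Gamma>" "\<gamma> \<in> \<Gamma>"
      and factor: "a = gmul (gmul a \<beta> x) \<gamma> a"
      using regular by blast
    have "gmul a \<beta> x \<in> gamma_prod \<Gamma> gmul A G"
      using a x by (auto intro: gamma_prodI)
    then have "gmul a \<beta> x \<in> A"
      using A unfolding gamma_ideal_def by blast
    then have "gmul (gmul a \<beta> x) \<gamma> a \<in> gamma_prod \<Gamma> gmul A B"
      using a x by (auto intro: gamma_prodI)
    then show "a \<in> gamma_prod \<Gamma> gmul A B"
      using factor by simp
  qed
qed

theorem theorem3:
  fixes G :: "'a set" and \<Gamma> :: "'g set" and gmul :: "'a \<Rightarrow> 'g \<Rightarrow> 'a \<Rightarrow> 'a"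
  assumes "regular_gamma_AG_groupoid G \<Gamma> gmul"
  shows "semilattice_on {I. gamma_ideal G \<Gamma> gmul I} (gamma_prod \<Gamma> gmul)"
proof -
  interpret regular_gamma_AG_groupoid G \<Gamma> gmul by (fact assms)
  show ?thesis
  proof unfold_locales
    show "{I. gamma_ideal G \<Gamma> gmul I} \<noteq> {}"
      using gamma_ideal_carrier by blast
  qed (auto simp: gamma_prod_ideals_eq_Int gamma_ideal_Int)
qed

end
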